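(* Let $\eta,\beta\colon W\to A$ be maps with a homotopy pushout square whose two structure maps $A\to\Sigma_A W$ are both the same map $\theta\colon A\to\Sigma_A W$. Let $f\colon\Sigma_AW\to X$ be any map, $\iota_X=f\circ\theta$, let $n\ge1$ with $\mathrm{secat}(\iota_X)\le n$, and let $\sigma\colon X\to G_n(\iota_X)$ be any homotopy section of $g_n\colon G_n(\iota_X)\to X$. With the maps $\omega_n$, $\theta_n^W$, $\bar\sigma$, $\pi$ defined in the context, the following conditions are equivalent: (i) $\sigma\circ f\simeq\omega_n$; (ii) $\pi$ has a homotopy section; (iii) $\pi$ is a homotopy epimorphism; (iv) $\theta_n^W\simeq\bar\sigma$.
   Context: Conventions. We work with pointed topological spaces and pointed maps; all constructions are up to homotopy and $\simeq$ denotes (pointed) homotopy. Homotopy commutative diagrams are understood in Mather's sense: each square comes with a chosen homotopy, and in a cube these homotopies are compatible. A "whisker map" $(a,b)$ is the map into a homotopy pullback (or out of a homotopy pushout) induced by its universal property from maps $a,b$ together with the relevant homotopy. A homotopy section of $g\colon G\to X$ is a map $\sigma\colon X\to G$ with $g\circ\sigma\simeq \mathrm{id}_X$. A map $p$ is a homotopy epimorphism if $u\circ p\simeq v\circ p$ implies $u\simeq v$. Ganea construction. For any map $\iota_X\colon A\to X$, put $G_0=A$, $g_0=\iota_X$, $\alpha_0=\mathrm{id}_A$. Inductively for $i\ge 0$, given $g_i\colon G_i\to X$, let $F_i$ be the homotopy pullback of $\iota_X$ and $g_i$, with projections $\eta_i\colon F_i\to A$ and $\beta_i\colon F_i\to G_i$;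 let $G_{i+1}$ be the homotopy pushout of $\eta_i$ and $\beta_i$, with structure maps $\alpha_{i+1}\colon A\to G_{i+1}$ and $\gamma_i\colon G_i\to G_{i+1}$; and let $g_{i+1}=(g_i,\iota_X)\colon G_{i+1}\to X$ be the induced whisker map, so $g_{i+1}\circ\gamma_i\simeq g_i$ and $g_{i+1}\circ\alpha_{i+1}\simeq\iota_X$. One has $\gamma_i\circ\alpha_i\simeq\alpha_{i+1}$. One writes $G_i(\iota_X)$ to show the dependence on $\iota_X$. $\mathrm{secat}(\iota_X)$ is the least $n\ge 0$ such that $g_n\colon G_n(\iota_X)\to X$ has a homotopy section. The map $\omega_n$. Let $\eta,\beta,\theta,f$ be as in the claim, $\iota_X=f\circ\theta$, $n\ge1$. The maps $\eta\colon W\to A$ and $\alpha_{n-1}\circ\beta\colon W\to G_{n-1}(\iota_X)$, with the homotopy $\iota_X\circ\eta= f\circ\theta\circ\eta\simeq f\circ\theta\circ\beta\simeq g_{n-1}\circ\alpha_{n-1}\circ\beta$ coming from the pushout square of $\Sigma_AW$, induce a whisker map $W\to F_{n-1}(\iota_X)$. Composing with the pushout square defining $G_n(\iota_X)$ gives a homotopy $\alpha_n\circ\eta\simeq\gamma_{n-1}\circ\alpha_{n-1}\circ\beta$, and the homotopy pushout $\Sigma_AW$ then induces $\omega_n\colon\Sigma_AW\to G_n(\iota_X)$, restricting to $\alpha_n$ on the copy of $A$ that is the target of $\eta$ and to $\gamma_{n-1}\circ\alpha_{n-1}$ on the copy that is the target of $\beta$. One has $g_n\circ\omega_n\simeq f$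 and $\omega_n\circ\theta\simeq\alpha_n$. The maps $\theta_n^W$, $\bar\sigma$, $\pi$. Let $H_n$ be the homotopy pullback of $g_n\colon G_n(\iota_X)\to X$ and $f\colon\Sigma_AW\to X$, with projections $f_n\colon H_n\to G_n(\iota_X)$ and $\eta_n^W\colon H_n\to\Sigma_AW$. Let $\theta_n^W=(\omega_n,\mathrm{id}_{\Sigma_AW})\colon\Sigma_AW\to H_n$ be the whisker map induced by $g_n\circ\omega_n\simeq f$; so $f_n\circ\theta_n^W\simeq\omega_n$ and $\eta_n^W\circ\theta_n^W\simeq\mathrm{id}$. Because $g_n\circ\sigma\simeq\mathrm{id}_X$, the homotopy pullback of $\sigma\colon X\to G_n(\iota_X)$ and $f_n\colon H_n\to G_n(\iota_X)$ is $\Sigma_AW$, with projection $f\colon\Sigma_AW\to X$ and a map $\bar\sigma\colon\Sigma_AW\to H_n$ (the other projection); so $f_n\circ\bar\sigma\simeq\sigma\circ f$ and $\eta_n^W\circ\bar\sigma\simeq\mathrm{id}_{\Sigma_AW}$. Finally let $Q$ be the homotopy pullback of $\theta_n^W\colon\Sigma_AW\to H_n$ and $\bar\sigma\colon\Sigma_AW\to H_n$, with projections $\pi,\pi'\colon Q\to\Sigma_AW$ satisfying $\theta_n^W\circ\pi\simeq\bar\sigma\circ\pi'$. *)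

theory Defs
  imports "HOL-Analysis.Analysis"
begin

section \<open>Pointed spaces and pointed homotopies\<close>

type_synonym 'a ptop = "'a topology \<times> 'a"

abbreviation spc :: "'a ptop \<Rightarrow> 'a topology" where "spc \<equiv> fst"
abbreviation pt :: "'a ptop \<Rightarrow> 'a" where "pt \<equiv> snd"

definition pspace :: "'a ptop \<Rightarrow> bool" where
  "pspace X \<longleftrightarrow> pt X \<in> topspace (spc X)"

definition pmap :: "'a ptop \<Rightarrow> 'b ptop \<Rightarrow> ('a \<Rightarrow> 'b) \<Rightarrow> bool" where
  "pmap X Y f \<longleftrightarrow> continuous_map (spc X) (spc Y) f \<and> f (pt X) = pt Y"

definition phomotopic :: "'a ptop \<Rightarrow> 'b ptop \<Rightarrow> ('a \<Rightarrow> 'b) \<Rightarrow> ('a \<Rightarrow> 'b) \<Rightarrow> bool" where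
  "phomotopic X Y f g \<longleftrightarrow> homotopic_with (\<lambda>h. h (pt X) = pt Y) (spc X) (spc Y) f g"

text \<open>A chosen homotopy, as opposed to the mere existence of one.\<close>

definition phomotopy ::
  "'a ptop \<Rightarrow> 'b ptop \<Rightarrow> ('a \<Rightarrow> 'b) \<Rightarrow> ('a \<Rightarrow> 'b) \<Rightarrow> (real \<times> 'a \<Rightarrow> 'b) \<Rightarrow> bool" where
  "phomotopy X Y f g H \<longleftrightarrow>
     continuous_map (prod_topology (top_of_set {0..1}) (spc X)) (spc Y) H \<and>
     (\<forall>x\<in>topspace (spc X). H (0, x) = f x \<and> H (1, x) = g x) \<and>
     (\<forall>t\<in>{0..1}. H (t, pt X) = pt Y)"

definition phomotopy_equiv :: "'a ptop \<Rightarrow> 'b ptop \<Rightarrow> ('a \<Rightarrow> 'b) \<Rightarrow> bool" where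
  "phomotopy_equiv X Y f \<longleftrightarrow> pmap X Y f \<and>
     (\<exists>g. pmap Y X g \<and> phomotopic X X (g \<circ> f) id \<and> phomotopic Y Y (f \<circ> g) id)"

definition homotopy_section :: "'a ptop \<Rightarrow> 'b ptop \<Rightarrow> ('a \<Rightarrow> 'b) \<Rightarrow> ('b \<Rightarrow> 'a) \<Rightarrow> bool" where
  "homotopy_section G X g \<sigma> \<longleftrightarrow> pmap X G \<sigma> \<and> phomotopic X X (g \<circ> \<sigma>) id"

text \<open>
  A formula cannot quantify over all types of test spaces \<open>Z\<close>. The type used here is large
  enough: the images of \<open>u\<close>, of \<open>v\<close> and of a homotopy \<open>u \<circ> p \<simeq> v \<circ> p\<close> lie in a subspace of \<open>Z\<close>
  with no more points than \<open>'y + 'y + real \<times> 'q\<close>. The lemma \<open>homotopy_epi_universal\<close> below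
  derives the property for test spaces of an arbitrary type.
\<close>

definition homotopy_epi :: "'q ptop \<Rightarrow> 'y ptop \<Rightarrow> ('q \<Rightarrow> 'y) \<Rightarrow> bool" where
  "homotopy_epi Q Y p \<longleftrightarrow>
     (\<forall>(Z :: ('y + 'y + real \<times> 'q) ptop) u v.
        pspace Z \<longrightarrow> pmap Y Z u \<longrightarrow> pmap Y Z v \<longrightarrow>
        phomotopic Q Z (u \<circ> p) (v \<circ> p) \<longrightarrow> phomotopic Y Z u v)"

section \<open>Homotopy pullbacks\<close>

text \<open>Paths are cut off outside the unit interval; the topology is the compact-open one.\<close>

definition paths_in :: "'a topology \<Rightarrow> (real \<Rightarrow> 'a) set" where
  "paths_in X = {p \<in> extensional {0..1}. pathin X p}"

definition path_space :: "'a topology \<Rightarrow> (real \<Rightarrow> 'a) topology" where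
  "path_space X =
     topology_generated_by
       {{p \<in> paths_in X. p ` K \<subseteq> U} | K U. compact K \<and> K \<subseteq> {0..1} \<and> openin X U}"

definition hpullback ::
  "'a ptop \<Rightarrow> 'b ptop \<Rightarrow> 'c ptop \<Rightarrow> ('a \<Rightarrow> 'c) \<Rightarrow> ('b \<Rightarrow> 'c) \<Rightarrow> ('a \<times> (real \<Rightarrow> 'c) \<times> 'b) ptop" where
  "hpullback X Y Z f g =
     (subtopology (prod_topology (spc X) (prod_topology (path_space (spc Z)) (spc Y)))
        {(x, p, y). p 0 = f x \<and> p 1 = g y},
      (pt X, restrict (\<lambda>t. pt Z) {0..1}, pt Y))"

definition hpb_fst :: "'a \<times> (real \<Rightarrow> 'c) \<times> 'b \<Rightarrow> 'a" where
  "hpb_fst = (\<lambda>(x, p, y). x)"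

definition hpb_snd :: "'a \<times> (real \<Rightarrow> 'c) \<times> 'b \<Rightarrow> 'b" where
  "hpb_snd = (\<lambda>(x, p, y). y)"

text \<open>The whisker map into \<open>hpullback X Y Z f g\<close> given by \<open>a\<close>, \<open>b\<close> and \<open>H : f \<circ> a \<simeq> g \<circ> b\<close>.\<close>

definition whisker_into ::
  "('v \<Rightarrow> 'a) \<Rightarrow> ('v \<Rightarrow> 'b) \<Rightarrow> (real \<times> 'v \<Rightarrow> 'c) \<Rightarrow> 'v \<Rightarrow> 'a \<times> (real \<Rightarrow> 'c) \<times> 'b" where
  "whisker_into a b H v = (a v, restrict (\<lambda>t. H (t, v)) {0..1}, b v)"

definition is_hpullback ::
  "'v ptop \<Rightarrow> 'a ptop \<Rightarrow> 'b ptop \<Rightarrow> 'c ptop \<Rightarrow> ('a \<Rightarrow> 'c) \<Rightarrow> ('b \<Rightarrow> 'c) \<Rightarrow>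
   ('v \<Rightarrow> 'a) \<Rightarrow> ('v \<Rightarrow> 'b) \<Rightarrow> (real \<times> 'v \<Rightarrow> 'c) \<Rightarrow> bool" where
  "is_hpullback V X Y Z f g a b H \<longleftrightarrow>
     pmap V X a \<and> pmap V Y b \<and> phomotopy V Z (f \<circ> a) (g \<circ> b) H \<and>
     phomotopy_equiv V (hpullback X Y Z f g) (whisker_into a b H)"

section \<open>Homotopy pushouts\<close>

text \<open>
  The homotopy pushout of \<open>f : W \<rightarrow> X\<close> and \<open>g : W \<rightarrow> Y\<close> is the reduced double mapping cylinder:
  the quotient of the disjoint union of \<open>X\<close>, \<open>{0..1} \<times> W\<close> and \<open>Y\<close> in which \<open>(0, w)\<close> is identified
  with \<open>f w\<close>, \<open>(1, w)\<close> with \<open>g w\<close>, and \<open>{0..1} \<times> {pt W}\<close> is collapsed to the common base point.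
  Each class has a unique normal form in the type \<open>cyl\<close>: the base point is \<open>CylL (pt X)\<close>,
  and the other classes are \<open>CylL x\<close>, \<open>CylR y\<close> with \<open>y \<noteq> pt Y\<close>, and \<open>CylM t w\<close> with \<open>0 < t < 1\<close>
  and \<open>w \<noteq> pt W\<close>. The maps \<open>cyl_left\<close>, \<open>cyl_mid\<close>, \<open>cyl_right\<close> are the three parts of the
  quotient map.
\<close>

datatype ('a, 'w, 'b) cyl = CylL 'a | CylM real 'w | CylR 'b

definition cyl_left :: "'a \<Rightarrow> ('a, 'w, 'b) cyl" where
  "cyl_left x = CylL x"

definition cyl_right :: "'a ptop \<Rightarrow> 'b ptop \<Rightarrow> 'b \<Rightarrow> ('a, 'w, 'b) cyl" where
  "cyl_right X Y y = (if y = pt Y then CylL (pt X) else CylR y)"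

definition cyl_mid ::
  "'w ptop \<Rightarrow> 'a ptop \<Rightarrow> 'b ptop \<Rightarrow> ('w \<Rightarrow> 'a) \<Rightarrow> ('w \<Rightarrow> 'b) \<Rightarrow> real \<times> 'w \<Rightarrow> ('a, 'w, 'b) cyl" where
  "cyl_mid W X Y f g = (\<lambda>(t, w).
     if w = pt W then CylL (pt X)
     else if t = 0 then cyl_left (f w)
     else if t = 1 then cyl_right X Y (g w)
     else CylM t w)"

definition cyl_points ::
  "'w ptop \<Rightarrow> 'a ptop \<Rightarrow> 'b ptop \<Rightarrow> ('w \<Rightarrow> 'a) \<Rightarrow> ('w \<Rightarrow> 'b) \<Rightarrow> ('a, 'w, 'b) cyl set" where
  "cyl_points W X Y f g =
     cyl_left ` topspace (spc X) \<union> cyl_right X Y ` topspace (spc Y) \<union>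
     cyl_mid W X Y f g ` ({0..1} \<times> topspace (spc W))"

definition cyl_open ::
  "'w ptop \<Rightarrow> 'a ptop \<Rightarrow> 'b ptop \<Rightarrow> ('w \<Rightarrow> 'a) \<Rightarrow> ('w \<Rightarrow> 'b) \<Rightarrow> ('a, 'w, 'b) cyl set \<Rightarrow> bool" where
  "cyl_open W X Y f g U \<longleftrightarrow>
     U \<subseteq> cyl_points W X Y f g \<and>
     openin (spc X) {x \<in> topspace (spc X). cyl_left x \<in> U} \<and>
     openin (spc Y) {y \<in> topspace (spc Y). cyl_right X Y y \<in> U} \<and>
     openin (prod_topology (top_of_set {0..1}) (spc W))
       {z \<in> {0..1} \<times> topspace (spc W). cyl_mid W X Y f g z \<in> U}"

definition hpushout ::
  "'w ptop \<Rightarrow> 'a ptop \<Rightarrow> 'b ptop \<Rightarrow> ('w \<Rightarrow> 'a) \<Rightarrow> ('w \<Rightarrow> 'b) \<Rightarrow> ('a, 'w, 'b) cyl ptop" where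
  "hpushout W X Y f g = (topology (cyl_open W X Y f g), CylL (pt X))"

text \<open>The whisker map out of \<open>hpushout W X Y f g\<close> given by \<open>u\<close>, \<open>v\<close> and \<open>H : u \<circ> f \<simeq> v \<circ> g\<close>.\<close>

definition whisker_out ::
  "('a \<Rightarrow> 'z) \<Rightarrow> ('b \<Rightarrow> 'z) \<Rightarrow> (real \<times> 'w \<Rightarrow> 'z) \<Rightarrow> ('a, 'w, 'b) cyl \<Rightarrow> 'z" where
  "whisker_out u v H c = (case c of CylL x \<Rightarrow> u x | CylM t w \<Rightarrow> H (t, w) | CylR y \<Rightarrow> v y)"

definition is_hpushout ::
  "'w ptop \<Rightarrow> 'a ptop \<Rightarrow> 'b ptop \<Rightarrow> 'p ptop \<Rightarrow> ('w \<Rightarrow> 'a) \<Rightarrow> ('w \<Rightarrow> 'b) \<Rightarrow>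
   ('a \<Rightarrow> 'p) \<Rightarrow> ('b \<Rightarrow> 'p) \<Rightarrow> (real \<times> 'w \<Rightarrow> 'p) \<Rightarrow> bool" where
  "is_hpushout W X Y P f g u v H \<longleftrightarrow>
     pmap X P u \<and> pmap Y P v \<and> phomotopy W P (u \<circ> f) (v \<circ> g) H \<and>
     phomotopy_equiv (hpushout W X Y f g) P (whisker_out u v H)"

section \<open>The Ganea construction\<close>

text \<open>
  One type holds the points of all \<open>G\<^sub>i\<close>: \<open>G\<^sub>0\<close> is the copy of \<open>A\<close> under \<open>Base\<close>, and \<open>G\<^sub>i\<^sub>+\<^sub>1\<close> is
  the copy of the double mapping cylinder of \<open>A \<leftarrow> F\<^sub>i \<rightarrow> G\<^sub>i\<close> under \<open>Glue\<close>.
\<close>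

datatype ('a, 'x) gpt =
    Base (unBase: 'a)
  | Glue (unGlue: "('a, 'a \<times> (real \<Rightarrow> 'x) \<times> ('a, 'x) gpt, ('a, 'x) gpt) cyl")

text \<open>The homeomorphic copy of a pointed space under an injection \<open>c\<close> with left inverse \<open>d\<close>.\<close>

definition pcopy :: "('a \<Rightarrow> 'b) \<Rightarrow> ('b \<Rightarrow> 'a) \<Rightarrow> 'a ptop \<Rightarrow> 'b ptop" where
  "pcopy c d X = (pullback_topology (range c) d (spc X), c (pt X))"

text \<open>The pair \<open>(G\<^sub>i, g\<^sub>i)\<close>.\<close>

primrec ganea ::
  "'a ptop \<Rightarrow> 'x ptop \<Rightarrow> ('a \<Rightarrow> 'x) \<Rightarrow> nat \<Rightarrow> ('a, 'x) gpt ptop \<times> (('a, 'x) gpt \<Rightarrow> 'x)" where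
  "ganea A X \<iota> 0 = (pcopy Base unBase A, \<iota> \<circ> unBase)"
| "ganea A X \<iota> (Suc i) =
     (let G = fst (ganea A X \<iota> i); g = snd (ganea A X \<iota> i); F = hpullback A G X \<iota> g in
       (pcopy Glue unGlue (hpushout F A G hpb_fst hpb_snd),
        whisker_out \<iota> g (\<lambda>(t, (a, p, y)). p t) \<circ> unGlue))"

definition ganea_space :: "'a ptop \<Rightarrow> 'x ptop \<Rightarrow> ('a \<Rightarrow> 'x) \<Rightarrow> nat \<Rightarrow> ('a, 'x) gpt ptop" where
  "ganea_space A X \<iota> i = fst (ganea A X \<iota> i)"

definition ganea_map :: "'a ptop \<Rightarrow> 'x ptop \<Rightarrow> ('a \<Rightarrow> 'x) \<Rightarrow> nat \<Rightarrow> ('a, 'x) gpt \<Rightarrow> 'x" where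
  "ganea_map A X \<iota> i = snd (ganea A X \<iota> i)"

definition ganea_fibre ::
  "'a ptop \<Rightarrow> 'x ptop \<Rightarrow> ('a \<Rightarrow> 'x) \<Rightarrow> nat \<Rightarrow> ('a \<times> (real \<Rightarrow> 'x) \<times> ('a, 'x) gpt) ptop" where
  "ganea_fibre A X \<iota> i = hpullback A (ganea_space A X \<iota> i) X \<iota> (ganea_map A X \<iota> i)"

primrec ganea_alpha :: "nat \<Rightarrow> 'a \<Rightarrow> ('a, 'x) gpt" where
  "ganea_alpha 0 = Base"
| "ganea_alpha (Suc i) = Glue \<circ> cyl_left"

definition ganea_gamma ::
  "'a ptop \<Rightarrow> 'x ptop \<Rightarrow> ('a \<Rightarrow> 'x) \<Rightarrow> nat \<Rightarrow> ('a, 'x) gpt \<Rightarrow> ('a, 'x) gpt" where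
  "ganea_gamma A X \<iota> i = Glue \<circ> cyl_right A (ganea_space A X \<iota> i)"

text \<open>The homotopy \<open>\<alpha>\<^sub>i\<^sub>+\<^sub>1 \<circ> \<eta>\<^sub>i \<simeq> \<gamma>\<^sub>i \<circ> \<beta>\<^sub>i\<close> of the pushout square defining \<open>G\<^sub>i\<^sub>+\<^sub>1\<close>.\<close>

definition ganea_square ::
  "'a ptop \<Rightarrow> 'x ptop \<Rightarrow> ('a \<Rightarrow> 'x) \<Rightarrow> nat \<Rightarrow>
   real \<times> 'a \<times> (real \<Rightarrow> 'x) \<times> ('a, 'x) gpt \<Rightarrow> ('a, 'x) gpt" where
  "ganea_square A X \<iota> i =
     Glue \<circ> cyl_mid (ganea_fibre A X \<iota> i) A (ganea_space A X \<iota> i) hpb_fst hpb_snd"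

definition secat :: "'a ptop \<Rightarrow> 'x ptop \<Rightarrow> ('a \<Rightarrow> 'x) \<Rightarrow> enat" where
  "secat A X \<iota> =
     Inf (enat ` {n. \<exists>\<sigma>. homotopy_section (ganea_space A X \<iota> n) X (ganea_map A X \<iota> n) \<sigma>})"

section \<open>The map from the homotopy pushout to the Ganea space\<close>

text \<open>
  \<open>T : \<theta> \<circ> \<eta> \<simeq> \<theta> \<circ> \<beta>\<close> is the homotopy of the given pushout square. Since
  \<open>g\<^sub>i \<circ> \<alpha>\<^sub>i = f \<circ> \<theta>\<close> holds strictly in this model, \<open>f \<circ> T\<close> is itself a homotopy from
  \<open>f \<circ> \<theta> \<circ> \<eta>\<close> to \<open>g\<^sub>i \<circ> \<alpha>\<^sub>i \<circ> \<beta>\<close>; it induces \<open>W \<rightarrow> F\<^sub>i\<close>.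
\<close>

definition fibre_lift ::
  "('w \<Rightarrow> 'a) \<Rightarrow> ('w \<Rightarrow> 'a) \<Rightarrow> (real \<times> 'w \<Rightarrow> 's) \<Rightarrow> ('s \<Rightarrow> 'x) \<Rightarrow> nat \<Rightarrow>
   'w \<Rightarrow> 'a \<times> (real \<Rightarrow> 'x) \<times> ('a, 'x) gpt" where
  "fibre_lift \<eta> \<beta> T f i = whisker_into \<eta> (ganea_alpha i \<circ> \<beta>) (f \<circ> T)"

text \<open>
  A whisker map out of an arbitrary homotopy pushout \<open>S\<close> is one whose composite with the
  equivalence from the double mapping cylinder onto \<open>S\<close> is homotopic to the whisker map out of
  the cylinder. This determines \<open>\<omega>\<close> up to homotopy.
\<close>

definition is_omega ::
  "'w ptop \<Rightarrow> 'a ptop \<Rightarrow> 's ptop \<Rightarrow> 'x ptop \<Rightarrow> ('w \<Rightarrow> 'a) \<Rightarrow> ('w \<Rightarrow> 'a) \<Rightarrow> ('a \<Rightarrow> 's) \<Rightarrow>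
   (real \<times> 'w \<Rightarrow> 's) \<Rightarrow> ('s \<Rightarrow> 'x) \<Rightarrow> nat \<Rightarrow> ('s \<Rightarrow> ('a, 'x) gpt) \<Rightarrow> bool" where
  "is_omega W A S X \<eta> \<beta> \<theta> T f n \<omega> \<longleftrightarrow>
     (let \<iota> = f \<circ> \<theta>; G = ganea_space A X \<iota> n in
       pmap S G \<omega> \<and>
       phomotopic (hpushout W A A \<eta> \<beta>) G
         (\<omega> \<circ> whisker_out \<theta> \<theta> T)
         (whisker_out (ganea_alpha n) (ganea_gamma A X \<iota> (n - 1) \<circ> ganea_alpha (n - 1))
            (\<lambda>(t, w). ganea_square A X \<iota> (n - 1) (t, fibre_lift \<eta> \<beta> T f (n - 1) w))))"

section \<open>Basic facts\<close>

lemma istopology_cyl_open: "istopology (cyl_open W X Y f g)"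
proof -
  have "cyl_open W X Y f g (U \<inter> V)" if "cyl_open W X Y f g U" "cyl_open W X Y f g V" for U V
  proof -
    have e: "{x \<in> B. q x \<in> U \<inter> V} = {x \<in> B. q x \<in> U} \<inter> {x \<in> B. q x \<in> V}" for B and q :: "'z \<Rightarrow> _"
      by auto
    show ?thesis
      using that unfolding cyl_open_def e by (auto intro: openin_Int)
  qed
  moreover have "cyl_open W X Y f g (\<Union>\<U>)" if "\<forall>U\<in>\<U>. cyl_open W X Y f g U" for \<U>
  proof -
    have e: "{x \<in> B. q x \<in> \<Union>\<U>} = (\<Union>U\<in>\<U>. {x \<in> B. q x \<in> U})" for B and q :: "'z \<Rightarrow> _"
      by auto
    show ?thesis
      using that unfolding cyl_open_def e by (auto intro!: openin_Union)
  qed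
  ultimately show ?thesis
    unfolding istopology_def by blast
qed

lemma openin_hpushout: "openin (spc (hpushout W X Y f g)) U \<longleftrightarrow> cyl_open W X Y f g U"
  by (simp add: hpushout_def istopology_cyl_open)

lemma phomotopic_alt:
  assumes "pspace X"
  shows "phomotopic X Y f g \<longleftrightarrow> (\<exists>H. phomotopy X Y f g H)"
proof -
  have "homotopic_with (\<lambda>h. h (pt X) = pt Y) (spc X) (spc Y) f g \<longleftrightarrow>
     (\<exists>h. continuous_map (prod_topology (top_of_set {0..1::real}) (spc X)) (spc Y) h \<and>
              (\<forall>x \<in> topspace (spc X). h(0,x) = f x) \<and>
              (\<forall>x \<in> topspace (spc X). h(1,x) = g x) \<and>
              (\<forall>t \<in> {0..1}. h (t, pt X) = pt Y))"
    by (rule homotopic_with[where P="\<lambda>h. h (pt X) = pt Y"]) (use assms in \<open>simp add: pspace_def\<close>)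
  then show ?thesis
    unfolding phomotopic_def phomotopy_def by blast
qed

lemma homotopy_epi_universal:
  fixes Z :: "'z ptop" and Q :: "'q ptop" and Y :: "'y ptop"
  assumes sp: "pspace Q" "pspace Y" "pspace Z"
    and epi: "homotopy_epi Q Y p"
    and u: "pmap Y Z u" and v: "pmap Y Z v" and h: "phomotopic Q Z (u \<circ> p) (v \<circ> p)"
  shows "phomotopic Y Z u v"
proof -
  obtain H where H: "phomotopy Q Z (u \<circ> p) (v \<circ> p) H"
    using h sp phomotopic_alt by blast
  define C :: "('y + 'y + real \<times> 'q) set" where
    "C = topspace (spc Y) <+> topspace (spc Y) <+> {0..1} \<times> topspace (spc Q)"
  define dec where "dec = case_sum u (case_sum v H)"
  define D where "D = dec ` C"
  define e where "e = inv_into C dec"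
  have dec_e: "dec (e z) = z" if "z \<in> D" for z
    using that unfolding D_def e_def by (rule f_inv_into_f)
  have uD: "u y \<in> D" "v y \<in> D" if "y \<in> topspace (spc Y)" for y
  proof -
    show "u y \<in> D" unfolding D_def dec_def C_def
      using that by (intro image_eqI[where x="Inl y"]) auto
    show "v y \<in> D" unfolding D_def dec_def C_def
      using that by (intro image_eqI[where x="Inr (Inl y)"]) auto
  qed
  have HD: "H z \<in> D" if "z \<in> {0..1} \<times> topspace (spc Q)" for z
    unfolding D_def dec_def C_def using that by (intro image_eqI[where x="Inr (Inr z)"]) auto
  have ptD: "pt Z \<in> D"
    using uD(1)[of "pt Y"] sp u by (simp add: pspace_def pmap_def)
  define Z' where "Z' = (pullback_topology (e ` D) dec (spc Z), e (pt Z))"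
  have into: "continuous_map T (spc Z') (e \<circ> k)"
    if "continuous_map T (spc Z) k" "k ` topspace T \<subseteq> D" for T :: "'t topology" and k
  proof -
    have "continuous_map T (spc Z) (dec \<circ> (e \<circ> k))"
      using that dec_e by (intro continuous_map_eq[OF that(1)]) auto
    moreover have "topspace T \<subseteq> (e \<circ> k) -` (e ` D)"
      using that(2) by auto
    ultimately show ?thesis
      unfolding Z'_def fst_conv by (rule continuous_map_pullback')
  qed
  have out: "continuous_map (spc Z') (spc Z) dec"
    unfolding Z'_def using continuous_map_pullback[OF continuous_map_id] by fastforce
  have Z': "pspace Z'"
    using ptD sp dec_e by (auto simp: pspace_def Z'_def topspace_pullback_topology)
  have u': "pmap Y Z' (e \<circ> u)" "pmap Y Z' (e \<circ> v)"
    using u v uD into[of "spc Y" u] into[of "spc Y" v] by (auto simp: pmap_def Z'_def)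
  have "phomotopy Q Z' ((e \<circ> u) \<circ> p) ((e \<circ> v) \<circ> p) (e \<circ> H)"
  proof -
    have "continuous_map (prod_topology (top_of_set {0..1}) (spc Q)) (spc Z') (e \<circ> H)"
      using H HD by (intro into) (auto simp: phomotopy_def)
    then show ?thesis
      using H by (auto simp: phomotopy_def Z'_def)
  qed
  then have "phomotopic Q Z' ((e \<circ> u) \<circ> p) ((e \<circ> v) \<circ> p)"
    using sp phomotopic_alt by blast
  then have "phomotopic Y Z' (e \<circ> u) (e \<circ> v)"
    using epi Z' u' unfolding homotopy_epi_def by blast
  then obtain K where K: "phomotopy Y Z' (e \<circ> u) (e \<circ> v) K"
    using sp phomotopic_alt by blast
  have "phomotopy Y Z u v (dec \<circ> K)"
    using K uD dec_e ptD continuous_map_compose[OF _ out]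
    by (auto simp: phomotopy_def Z'_def)
  then show ?thesis
    using sp phomotopic_alt by blast
qed

lemma topspace_hpushout:
  assumes "pmap W X f" "pmap W Y g" "pspace X"
  shows "topspace (spc (hpushout W X Y f g)) = cyl_points W X Y f g"
proof -
  have "cyl_open W X Y f g (cyl_points W X Y f g)"
  proof -
    have "{x \<in> topspace (spc X). cyl_left x \<in> cyl_points W X Y f g} = topspace (spc X)"
      "{y \<in> topspace (spc Y). cyl_right X Y y \<in> cyl_points W X Y f g} = topspace (spc Y)"
      "{z \<in> {0..1} \<times> topspace (spc W). cyl_mid W X Y f g z \<in> cyl_points W X Y f g}
         = topspace (prod_topology (top_of_set {0..1}) (spc W))"
      by (auto simp: cyl_points_def)
    then show ?thesis
      unfolding cyl_open_def by (metis openin_topspace order_refl)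
  qed
  then have "openin (spc (hpushout W X Y f g)) (cyl_points W X Y f g)"
    by (simp only: openin_hpushout)
  then have "cyl_points W X Y f g \<subseteq> topspace (spc (hpushout W X Y f g))"
    by (rule openin_subset)
  moreover have "cyl_open W X Y f g (topspace (spc (hpushout W X Y f g)))"
    by (simp only: openin_topspace flip: openin_hpushout)
  then have "topspace (spc (hpushout W X Y f g)) \<subseteq> cyl_points W X Y f g"
    by (simp only: cyl_open_def)
  ultimately show ?thesis
    by (rule equalityI[rotated])
qed

lemma whisker_out_pmap:
  assumes X: "pspace X" and Y: "pspace Y" and W: "pspace W"
    and f: "pmap W X f" and g: "pmap W Y g" and u: "pmap X P u" and v: "pmap Y P v"
    and H: "phomotopy W P (u \<circ> f) (v \<circ> g) H"
  shows "pmap (hpushout W X Y f g) P (whisker_out u v H)"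
proof -
  let ?k = "whisker_out u v H"
  have 1: "?k (cyl_left x) = u x" for x by (simp add: whisker_out_def cyl_left_def)
  have 2: "?k (cyl_right X Y y) = v y" for y
    using u v by (simp add: whisker_out_def cyl_right_def pmap_def)
  have 3: "?k (cyl_mid W X Y f g (t, w)) = H (t, w)" if "t \<in> {0..1}" "w \<in> topspace (spc W)" for t w
    using H that 2 1 u by (auto simp: cyl_mid_def phomotopy_def pmap_def whisker_out_def)
  have "continuous_map (spc (hpushout W X Y f g)) (spc P) ?k"
    unfolding continuous_map topspace_hpushout[OF f g X]
  proof (intro conjI allI impI)
    have "H z \<in> topspace (spc P)" if "z \<in> {0..1} \<times> topspace (spc W)" for z
      using H that by (auto simp: phomotopy_def continuous_map_def Pi_iff)
    then show "?k ` cyl_points W X Y f g \<subseteq> topspace (spc P)"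
      using u v by (auto simp: cyl_points_def 1 2 3 pmap_def continuous_map_def Pi_iff)
  next
    fix U assume U: "openin (spc P) U"
    let ?V = "{c \<in> cyl_points W X Y f g. ?k c \<in> U}"
    have a: "{x \<in> topspace (spc X). cyl_left x \<in> ?V} = {x \<in> topspace (spc X). u x \<in> U}"
      by (auto simp: cyl_points_def 1)
    have b: "{y \<in> topspace (spc Y). cyl_right X Y y \<in> ?V} = {y \<in> topspace (spc Y). v y \<in> U}"
      by (auto simp: cyl_points_def 2)
    have c: "{z \<in> {0..1} \<times> topspace (spc W). cyl_mid W X Y f g z \<in> ?V}
       = {z \<in> topspace (prod_topology (top_of_set {0..1}) (spc W)). H z \<in> U}"
    proof -
      have "cyl_mid W X Y f g z \<in> ?V \<longleftrightarrow> H z \<in> U" if "z \<in> {0..1} \<times> topspace (spc W)" for z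
      proof -
        have "cyl_mid W X Y f g z \<in> cyl_points W X Y f g"
          using that unfolding cyl_points_def by (intro UnI2 imageI)
        moreover have "?k (cyl_mid W X Y f g z) = H z"
          using that 3 by (cases z) auto
        ultimately show ?thesis by (simp only: mem_Collect_eq simp_thms)
      qed
      then show ?thesis
        unfolding topspace_prod_topology topspace_euclidean_subtopology by (intro Collect_cong conj_cong refl)
    qed
    have "continuous_map (spc X) (spc P) u" "continuous_map (spc Y) (spc P) v"
      "continuous_map (prod_topology (top_of_set {0..1}) (spc W)) (spc P) H"
      using u v H by (auto simp: pmap_def phomotopy_def)
    note o = this[THEN openin_continuous_map_preimage, OF U]
    show "openin (spc (hpushout W X Y f g)) ?V"
      unfolding openin_hpushout cyl_open_def a b c by (intro conjI o) simp
  qed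
  then show ?thesis
    using u by (simp add: pmap_def hpushout_def whisker_out_def)
qed

lemma openin_path_space_sub:
  assumes "compact K" "K \<subseteq> {0..1}" "openin X U"
  shows "openin (path_space X) {p \<in> paths_in X. p ` K \<subseteq> U}"
  unfolding path_space_def by (rule topology_generated_by_Basis) (use assms in blast)

lemma topspace_path_space: "topspace (path_space X) = paths_in X"
proof -
  have "{p \<in> paths_in X. p ` {0..1} \<subseteq> topspace X} = paths_in X"
    by (auto simp: paths_in_def pathin_def continuous_map_def)
  moreover have "topspace (path_space X) \<subseteq> paths_in X"
    by (auto simp: path_space_def topology_generated_by_topspace)
  ultimately show ?thesis
    using openin_subset[OF openin_path_space_sub[of "{0..1}" X "topspace X"]] by force
qed

lemma continuous_map_path_eval:
  "continuous_map (prod_topology (top_of_set {0..1}) (path_space X)) X (\<lambda>(t, p). p t)"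
  unfolding continuous_map
proof (intro conjI allI impI)
  show "(\<lambda>(t, p). p t) ` topspace (prod_topology (top_of_set {0..1}) (path_space X)) \<subseteq> topspace X"
    by (auto simp: topspace_path_space paths_in_def pathin_def continuous_map_def)
next
  fix U assume U: "openin X U"
  let ?S = "{z \<in> topspace (prod_topology (top_of_set {0..1}) (path_space X)). (case z of (t, p) \<Rightarrow> p t) \<in> U}"
  show "openin (prod_topology (top_of_set {0..1}) (path_space X)) ?S"
  proof (subst openin_subopen, intro ballI)
    fix z assume "z \<in> ?S"
    then obtain t p where z: "z = (t, p)" "t \<in> {0..1}" "p \<in> paths_in X" "p t \<in> U"
      by (auto simp: topspace_path_space)
    have "openin (top_of_set {0..1}) {s \<in> {0..1::real}. p s \<in> U}"
      using z(3) U by (auto simp: paths_in_def pathin_def continuous_map)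
    then obtain e where e: "e > 0" "ball t e \<inter> {0..1} \<subseteq> {s \<in> {0..1::real}. p s \<in> U}"
      using z by (auto simp: openin_contains_ball)
    define K where "K = cball t (e/2) \<inter> {0..1}"
    have K: "compact K" "K \<subseteq> {0..1}" "p ` K \<subseteq> U"
      using e by (auto simp: K_def subset_eq compact_Int_closed) 
    let ?T = "(ball t (e/2) \<inter> {0..1}) \<times> {q \<in> paths_in X. q ` K \<subseteq> U}"
    have "openin (prod_topology (top_of_set {0..1}) (path_space X)) ?T"
      using openin_path_space_sub[OF K(1,2) U]
      by (auto simp: openin_prod_Times_iff openin_open_Int Int_commute)
    moreover have "z \<in> ?T" using z K e by auto
    moreover have "?T \<subseteq> ?S" by (auto simp: topspace_path_space K_def)
    ultimately show "\<exists>T. openin (prod_topology (top_of_set {0..1}) (path_space X)) T \<and> z \<in> T \<and> T \<subseteq> ?S"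
      by blast
  qed
qed

lemma topspace_hpullback:
  "topspace (spc (hpullback X Y Z f g)) =
     {(x, p, y). x \<in> topspace (spc X) \<and> p \<in> paths_in (spc Z) \<and> y \<in> topspace (spc Y) \<and> p 0 = f x \<and> p 1 = g y}"
  by (auto simp: hpullback_def topspace_path_space)

lemma hpullback_pspace:
  assumes "pspace X" "pspace Y" "pspace Z" "pmap X Z f" "pmap Y Z g"
  shows "pspace (hpullback X Y Z f g)"
  using assms unfolding pspace_def topspace_hpullback
  by (auto simp: hpullback_def pmap_def paths_in_def pathin_def intro: continuous_map_eq[of _ _ "\<lambda>t. pt Z"])

lemma hpb_pmap:
  "pmap (hpullback X Y Z f g) X hpb_fst" "pmap (hpullback X Y Z f g) Y hpb_snd"
proof -
  have e: "hpb_fst = fst" "hpb_snd = snd \<circ> snd" by (auto simp: hpb_fst_def hpb_snd_def)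
  show "pmap (hpullback X Y Z f g) X hpb_fst" "pmap (hpullback X Y Z f g) Y hpb_snd"
    unfolding pmap_def hpullback_def e
    by (auto intro!: continuous_map_from_subtopology continuous_map_compose continuous_map_fst continuous_map_snd)
qed

lemma hpb_homotopy:
  assumes "pmap X Z f" "pmap Y Z g"
  shows "phomotopy (hpullback X Y Z f g) Z (f \<circ> hpb_fst) (g \<circ> hpb_snd) (\<lambda>(t,(a,p,y)). p t)"
proof -
  let ?F = "hpullback X Y Z f g"
  let ?P = "prod_topology (top_of_set {0..1::real}) (spc ?F)"
  have "continuous_map ?P (path_space (spc Z)) (fst \<circ> (snd \<circ> snd))"
  proof (rule continuous_map_compose)
    show "continuous_map (prod_topology (path_space (spc Z)) (spc Y)) (path_space (spc Z)) fst"
      by (rule continuous_map_fst)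
    have "continuous_map (spc ?F) (prod_topology (path_space (spc Z)) (spc Y)) snd"
      unfolding hpullback_def fst_conv
      by (intro continuous_map_from_subtopology continuous_map_snd)
    then show "continuous_map ?P (prod_topology (path_space (spc Z)) (spc Y)) (snd \<circ> snd)"
      by (rule continuous_map_compose[OF continuous_map_snd])
  qed
  then have "continuous_map ?P (prod_topology (top_of_set {0..1}) (path_space (spc Z)))
      (\<lambda>z. (fst z, (fst \<circ> (snd \<circ> snd)) z))"
    by (intro continuous_map_pairedI continuous_map_fst)
  from continuous_map_compose[OF this continuous_map_path_eval]
  have "continuous_map ?P (spc Z) (\<lambda>(t,(a,p,y)). p t)"
    by (simp add: comp_def case_prod_unfold)
  then show ?thesis
    unfolding phomotopy_def
    by (auto simp: topspace_hpullback hpb_fst_def hpb_snd_def) (auto simp: hpullback_def)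
qed

lemma pcopy:
  assumes "\<And>x. d (c x) = x" 
  shows "pspace X \<Longrightarrow> pspace (pcopy c d X)" "pmap X Y h \<Longrightarrow> pmap (pcopy c d X) Y (h \<circ> d)"
  using assms by (auto simp: pcopy_def pspace_def pmap_def topspace_pullback_topology intro: continuous_map_pullback)

lemma pspace_hpushout:
  assumes "pmap W X f" "pmap W Y g" "pspace X"
  shows "pspace (hpushout W X Y f g)"
  using assms unfolding pspace_def topspace_hpushout[OF assms]
  by (auto simp: hpushout_def cyl_points_def cyl_left_def)

lemma ganea_ok:
  assumes A: "pspace A" and X: "pspace X" and i: "pmap A X \<iota>"
  shows "pspace (ganea_space A X \<iota> n) \<and> pmap (ganea_space A X \<iota> n) X (ganea_map A X \<iota> n)
    \<and> (\<forall>a. ganea_map A X \<iota> n (ganea_alpha n a) = \<iota> a)"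
proof (induction n)
  case 0
  show ?case
  proof -
    have "pspace (pcopy Base unBase A)" "pmap (pcopy Base unBase A) X (\<iota> \<circ> unBase)"
      using pcopy[where c=Base and d=unBase] A i by (metis gpt.sel(1))+
    then show ?thesis by (simp add: ganea_space_def ganea_map_def comp_def)
  qed
next
  case (Suc n)
  let ?G = "ganea_space A X \<iota> n" and ?g = "ganea_map A X \<iota> n"
  let ?F = "hpullback A ?G X \<iota> ?g"
  have G: "pspace ?G" "pmap ?G X ?g" using Suc by auto
  have "pspace (hpushout ?F A ?G hpb_fst hpb_snd)"
    using A by (intro pspace_hpushout hpb_pmap)
  moreover have "pmap (hpushout ?F A ?G hpb_fst hpb_snd) X (whisker_out \<iota> ?g (\<lambda>(t,(a,p,y)). p t))"
    using A X G i by (intro whisker_out_pmap hpb_pmap hpb_homotopy hpullback_pspace)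
  ultimately show ?case
  proof -
    let ?C = "hpushout ?F A ?G hpb_fst hpb_snd" and ?k = "whisker_out \<iota> ?g (\<lambda>(t,(a,p,y)). p t)"
    assume C: "pspace ?C" "pmap ?C X ?k"
    have "pspace (pcopy Glue unGlue ?C)" "pmap (pcopy Glue unGlue ?C) X (?k \<circ> unGlue)"
      using pcopy[where c=Glue and d=unGlue] C by (metis gpt.sel(2))+
    moreover have "ganea_space A X \<iota> (Suc n) = pcopy Glue unGlue ?C"
      and "ganea_map A X \<iota> (Suc n) = ?k \<circ> unGlue"
      by (simp_all add: ganea_space_def ganea_map_def Let_def)
    moreover have "(?k \<circ> unGlue) (ganea_alpha (Suc n) a) = \<iota> a" for a
      by (simp add: whisker_out_def cyl_left_def)
    ultimately show ?case
      by (simp only: simp_thms)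
  qed
qed

text \<open>A homotopy \<open>g\<^sub>n \<circ> \<omega> \<simeq> f\<close>, needed to form the whisker map \<open>(\<omega>, id)\<close>, exists for every \<open>\<omega>\<close>.\<close>

lemma ganea_map_omega:
  assumes sp: "pspace W" "pspace A" "pspace S" "pspace X"
    and maps: "pmap W A \<eta>" "pmap W A \<beta>"
    and pushout: "is_hpushout W A A S \<eta> \<beta> \<theta> \<theta> T"
    and f: "pmap S X f" and n: "n \<ge> 1"
    and \<omega>: "is_omega W A S X \<eta> \<beta> \<theta> T f n \<omega>"
  shows "phomotopic S X (ganea_map A X (f \<circ> \<theta>) n \<circ> \<omega>) f"
proof -
  let ?i = "f \<circ> \<theta>"
    obtain m where m: "n = Suc m" using n by (cases n) auto
  have th: "pmap A S \<theta>" and T: "phomotopy W S (\<theta> \<circ> \<eta>) (\<theta> \<circ> \<beta>) T"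
    using pushout by (auto simp: is_hpushout_def)
  have i: "pmap A X ?i" using th f by (auto simp: pmap_def intro: continuous_map_compose)
  note G = ganea_ok[OF sp(2,4) i]
  let ?C = "hpushout W A A \<eta> \<beta>" and ?c = "whisker_out \<theta> \<theta> T"
  let ?w = "whisker_out (ganea_alpha n) (ganea_gamma A X ?i (n - 1) \<circ> ganea_alpha (n - 1))
            (\<lambda>(t, w). ganea_square A X ?i (n - 1) (t, fibre_lift \<eta> \<beta> T f (n - 1) w))"
  have C: "pspace ?C" using maps sp by (intro pspace_hpushout)
  have ptG: "ganea_map A X ?i k (pt (ganea_space A X ?i k)) = pt X" for k using G[of k] by (auto simp: pmap_def)
  let ?g = "ganea_map A X ?i n"
  have strict: "?g (?w z) = f (?c z)" if "z \<in> topspace (spc ?C)" for z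
  proof -
    have gS: "ganea_map A X ?i (Suc m) (Glue k) = whisker_out ?i (ganea_map A X ?i m) (\<lambda>(t,(a,p,y)). p t) k" for k
      by (simp add: ganea_map_def Let_def)
    have r: "whisker_out ?i (ganea_map A X ?i m) (\<lambda>(t,(a,p,y)). p t) (cyl_right A (ganea_space A X ?i m) y) =
         ganea_map A X ?i m y" for y
      using ptG[of m] G[of m] i by (auto simp: cyl_right_def whisker_out_def pmap_def)
    have fl: "fibre_lift \<eta> \<beta> T f m w = (\<eta> w, restrict (\<lambda>t. f (T (t, w))) {0..1}, ganea_alpha m (\<beta> w))" for w
      by (simp add: fibre_lift_def whisker_into_def)
    have mid: "ganea_map A X ?i (Suc m) (ganea_square A X ?i m (t, fibre_lift \<eta> \<beta> T f m w)) = f (T (t, w))"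
      if t: "t \<in> {0..1}" and w: "w \<in> topspace (spc W)" for t w
    proof (cases "fibre_lift \<eta> \<beta> T f m w = pt (ganea_fibre A X ?i m)")
      case True
      then have "restrict (\<lambda>t. f (T (t, w))) {0..1} = restrict (\<lambda>t. pt X) {0..1}"
        by (simp add: fl ganea_fibre_def hpullback_def)
      from fun_cong[OF this, of t] True show ?thesis
        using t i by (simp add: ganea_square_def gS cyl_mid_def whisker_out_def pmap_def)
    next
      case False
      then show ?thesis
        using t w T G[of m]
        by (auto simp: ganea_square_def gS cyl_mid_def r fl hpb_fst_def hpb_snd_def phomotopy_def cyl_left_def)
           (auto simp: whisker_out_def fl)
    qed
    have fpt: "f (pt S) = pt X" "\<theta> (pt A) = pt S" using f th by (auto simp: pmap_def)
    have L: "?g (?w (CylL x)) = f (?c (CylL x))" for x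
      using G[of n] by (simp add: whisker_out_def)
    have R: "?g (?w (CylR y)) = f (?c (CylR y))" for y
    proof -
      have "?g (ganea_gamma A X ?i m (ganea_alpha m y)) = f (\<theta> y)"
        using G[of m] unfolding m ganea_gamma_def by (simp add: gS r)
      then show ?thesis by (simp add: whisker_out_def m)
    qed
    have M: "?g (?w (CylM t w)) = f (?c (CylM t w))" if "t \<in> {0..1}" "w \<in> topspace (spc W)" for t w
      using mid[OF that] by (simp add: whisker_out_def m)
    from that show ?thesis
      unfolding topspace_hpushout[OF maps sp(2)] cyl_points_def
    proof (elim UnE imageE)
      fix x assume "z = cyl_left x" then show ?thesis using L by (simp add: cyl_left_def)
    next
      fix y assume "z = cyl_right A A y" then show ?thesis using L R by (simp add: cyl_right_def)
    next
      fix q assume q: "z = cyl_mid W A A \<eta> \<beta> q" "q \<in> {0..1} \<times> topspace (spc W)"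
      obtain t w where "q = (t, w)" by (cases q)
      then show ?thesis using q L R M[of t w] by (simp add: cyl_mid_def cyl_left_def cyl_right_def)
    qed
  qed
  have gp: "pmap (ganea_space A X ?i n) X ?g" and wp: "pmap S (ganea_space A X ?i n) \<omega>"
    using G \<omega> by (auto simp: is_omega_def Let_def)
  have 1: "phomotopic ?C (ganea_space A X ?i n) (\<omega> \<circ> ?c) ?w"
    using \<omega> by (simp add: is_omega_def Let_def)
  then obtain K where K: "phomotopy ?C (ganea_space A X ?i n) (\<omega> \<circ> ?c) ?w K"
    using C phomotopic_alt by blast
  have K': "phomotopy ?C X (?g \<circ> \<omega> \<circ> ?c) (f \<circ> ?c) (?g \<circ> K)"
    using K gp strict by (auto simp: phomotopy_def pmap_def intro: continuous_map_compose)
  then have a: "phomotopic ?C X (?g \<circ> \<omega> \<circ> ?c) (f \<circ> ?c)"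
    using C phomotopic_alt by blast
  obtain d where d: "pmap S ?C d" "phomotopic S S (?c \<circ> d) id"
    using pushout by (auto simp: is_hpushout_def phomotopy_equiv_def)
  have pre: "phomotopic S X (h \<circ> d) (k \<circ> d)" if "phomotopic ?C X h k" for h k
    using that unfolding phomotopic_def
    by (rule homotopic_with_compose_continuous_map_right[where p="\<lambda>h. h (pt ?C) = pt X" and q="\<lambda>h. h (pt S) = pt X"]) (use d(1) in \<open>auto simp: pmap_def\<close>)
  have post: "phomotopic S X (h \<circ> (?c \<circ> d)) (h \<circ> id)" if "pmap S X h" for h
    using d(2) unfolding phomotopic_def
    by (rule homotopic_with_compose_continuous_map_left[where p="\<lambda>h. h (pt S) = pt S" and q="\<lambda>h. h (pt S) = pt X"]) (use that in \<open>auto simp: pmap_def\<close>)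
  have "phomotopic S X (?g \<circ> \<omega>) (?g \<circ> \<omega> \<circ> (?c \<circ> d))"
    using post[of "?g \<circ> \<omega>"] gp wp unfolding phomotopic_def pmap_def
    by (auto intro: homotopic_with_symD continuous_map_compose)
  moreover have "phomotopic S X (?g \<circ> \<omega> \<circ> (?c \<circ> d)) (f \<circ> (?c \<circ> d))"
    using pre[OF a] by (simp add: comp_assoc)
  moreover have "phomotopic S X (f \<circ> (?c \<circ> d)) f"
    using post[OF f] by simp
  ultimately show ?thesis
    unfolding phomotopic_def by (meson homotopic_with_trans)
qed

end

theory Submission
  imports Defs
begin

text \<open>
  The space \<open>H = hpullback G S X g f\<close> sits over \<open>G\<close> by \<open>hpb_fst\<close> and over \<open>S\<close> by \<open>hpb_snd\<close>. Both
  \<open>\<theta>W\<close> and \<open>\<sigma>bar\<close> are homotopy sections of \<open>hpb_snd\<close>, and composing them with \<open>hpb_fst\<close> gives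
  \<open>\<omega>\<close> and, up to homotopy, \<open>\<sigma> \<circ> f\<close>. The equivalences follow from two observations.

  \<^item> Two homotopy sections \<open>s\<close>, \<open>t\<close> of the same map \<open>r\<close> are homotopic as soon as one factors through
    the other up to homotopy: if \<open>s \<simeq> t \<circ> k\<close>, applying \<open>r\<close> gives \<open>id \<simeq> k\<close>, hence \<open>s \<simeq> t\<close>
    (\<open>phomotopic_sections_if_factor\<close>).

  \<^item> The homotopy pullback \<open>Q\<close> of two such sections measures their difference. Its universal homotopy
    \<open>s \<circ> \<pi> \<simeq> t \<circ> \<pi>'\<close> becomes \<open>\<pi> \<simeq> \<pi>'\<close> after applying \<open>r\<close>, so \<open>s \<circ> \<pi> \<simeq> t \<circ> \<pi>\<close>. Thus \<open>s \<simeq> t\<close> as soon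
    as \<open>\<pi>\<close> can be cancelled, which holds if it is a homotopy epimorphism and in particular if it has a
    homotopy section. Conversely a homotopy \<open>s \<simeq> t\<close> lifts the identity of \<open>S\<close> to a section of \<open>\<pi>\<close>.
    This makes (ii), (iii) and (iv) equivalent (\<open>homotopy_epi_if_section\<close>,
    \<open>sections_coincide_if_projection_epi\<close>, \<open>projection_has_section_if_phomotopic\<close>).

  It remains to compare (i) and (iv). Applying \<open>hpb_fst\<close> to \<open>\<theta>W \<simeq> \<sigma>bar\<close> gives \<open>\<omega> \<simeq> \<sigma> \<circ> f\<close>. For the
  converse, \<open>\<sigma>bar\<close> is by assumption the pullback of \<open>\<sigma>\<close> along \<open>hpb_fst\<close>, so a homotopy
  \<open>\<sigma> \<circ> f \<simeq> \<omega> = hpb_fst \<circ> \<theta>W\<close> makes \<open>\<theta>W\<close> factor through \<open>\<sigma>bar\<close> (\<open>is_hpullback_lift\<close>), and the first observation applies.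
\<close>

section \<open>Calculus of pointed homotopies\<close>

lemma pmap_id: "pmap X X id"
  by (simp add: pmap_def)

lemma pmap_comp: "pmap X Y f \<Longrightarrow> pmap Y Z g \<Longrightarrow> pmap X Z (g \<circ> f)"
  by (auto simp: pmap_def intro: continuous_map_compose)

lemma phomotopic_refl: "pmap X Y f \<Longrightarrow> phomotopic X Y f f"
  by (simp add: phomotopic_def pmap_def)

lemma phomotopic_sym: "phomotopic X Y f g \<Longrightarrow> phomotopic X Y g f"
  by (simp add: phomotopic_def homotopic_with_sym)

lemma phomotopic_trans [trans]:
  "phomotopic X Y f g \<Longrightarrow> phomotopic X Y g h \<Longrightarrow> phomotopic X Y f h"
  unfolding phomotopic_def by (rule homotopic_with_trans)

lemma phomotopic_comp_left:
  assumes "phomotopic X Y f g" "pmap Y Z h"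
  shows "phomotopic X Z (h \<circ> f) (h \<circ> g)"
  using assms unfolding phomotopic_def pmap_def
  by (auto intro: homotopic_with_compose_continuous_map_left)

lemma phomotopic_comp_right:
  assumes "phomotopic Y Z f g" "pmap X Y h"
  shows "phomotopic X Z (f \<circ> h) (g \<circ> h)"
  using assms unfolding phomotopic_def pmap_def
  by (auto intro: homotopic_with_compose_continuous_map_right)

section \<open>Universal property of the homotopy pullback\<close>

text \<open>
  One half of the exponential law for the compact-open topology. Pulling back a subbasic open set
  gives the points whose whole slice over a compact \<open>K\<close> is mapped into an open set, and this is open
  by the tube lemma.
\<close>

lemma continuous_map_curry_path_space:
  assumes H: "continuous_map (prod_topology (top_of_set {0..1}) V) Z H"
  shows "continuous_map V (path_space Z) (\<lambda>v. restrict (\<lambda>t. H (t, v)) {0..1})"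
proof -
  let ?h = "\<lambda>v. restrict (\<lambda>t. H (t, v)) {0..1}"
  have path: "?h v \<in> paths_in Z" if v: "v \<in> topspace V" for v
  proof -
    have "continuous_map (top_of_set {0..1}) (prod_topology (top_of_set {0..1}) V) (\<lambda>t. (t, v))"
      using v by (intro continuous_map_pairedI) auto
    from continuous_map_compose[OF this H]
    have "continuous_map (top_of_set {0..1}) Z (\<lambda>t. H (t, v))"
      by (simp add: comp_def)
    then have "continuous_map (top_of_set {0..1}) Z (?h v)"
      by (rule continuous_map_eq) auto
    then show ?thesis
      by (simp add: paths_in_def pathin_def)
  qed
  have preimage: "openin V {v \<in> topspace V. ?h v \<in> paths_in Z \<and> ?h v ` K \<subseteq> U}"
    if K: "compact K" "K \<subseteq> {0..1}" and U: "openin Z U" for K U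
  proof (subst openin_subopen, intro ballI)
    let ?W = "{z \<in> topspace (prod_topology (top_of_set {0..1}) V). H z \<in> U}"
    fix v assume v: "v \<in> {v \<in> topspace V. ?h v \<in> paths_in Z \<and> ?h v ` K \<subseteq> U}"
    have "H (t, v) \<in> U" if "t \<in> K" for t
      using v K(2) that by (auto simp: image_subset_iff subset_iff)
    then have "K \<times> {v} \<subseteq> ?W"
      using v K(2) by (auto simp: subset_iff)
    moreover have "compactin (top_of_set {0..1}) K"
      using K by (simp add: compactin_subtopology)
    moreover have "openin (prod_topology (top_of_set {0..1}) V) ?W"
      using H U by (rule openin_continuous_map_preimage)
    ultimately obtain A B where A: "K \<subseteq> A" and B: "openin V B" "v \<in> B" and AB: "A \<times> B \<subseteq> ?W"
      using tube_lemma_left[of "top_of_set {0..1}" V ?W K v] v by blast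
    have near: "u \<in> topspace V \<and> ?h u \<in> paths_in Z \<and> ?h u ` K \<subseteq> U" if u: "u \<in> B" for u
    proof -
      have "H (t, u) \<in> U" if "t \<in> K" for t
        using that u A AB by blast
      moreover have "u \<in> topspace V"
        using u B(1) openin_subset by blast
      ultimately show ?thesis
        using path[of u] K(2) by (auto simp: image_subset_iff)
    qed
    show "\<exists>B. openin V B \<and> v \<in> B \<and>
        B \<subseteq> {v \<in> topspace V. ?h v \<in> paths_in Z \<and> ?h v ` K \<subseteq> U}"
      by (intro exI[of _ B] conjI B subsetI CollectI near)
  qed
  show ?thesis
    unfolding path_space_def
  proof (rule continuous_on_generated_topo)
    fix B assume "B \<in> {{p \<in> paths_in Z. p ` K \<subseteq> U} | K U. compact K \<and> K \<subseteq> {0..1} \<and> openin Z U}"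
    then obtain K U where B: "B = {p \<in> paths_in Z. p ` K \<subseteq> U}"
      and KU: "compact K" "K \<subseteq> {0..1}" "openin Z U"
      by blast
    have "?h -` B \<inter> topspace V = {v \<in> topspace V. ?h v \<in> paths_in Z \<and> ?h v ` K \<subseteq> U}"
      unfolding B by auto
    then show "openin V (?h -` B \<inter> topspace V)"
      using preimage[OF KU] by metis
  next
    have "paths_in Z \<subseteq>
      \<Union> {{p \<in> paths_in Z. p ` K \<subseteq> U} | K U. compact K \<and> K \<subseteq> {0..1} \<and> openin Z U}"
      by (rule Union_upper) (auto intro!: exI[of _ "{}"])
    then show "?h ` topspace V \<subseteq>
      \<Union> {{p \<in> paths_in Z. p ` K \<subseteq> U} | K U. compact K \<and> K \<subseteq> {0..1} \<and> openin Z U}"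
      using path by blast
  qed
qed

lemma whisker_into_pmap:
  assumes V: "pspace V" and a: "pmap V X a" and b: "pmap V Y b"
    and H: "phomotopy V Z (f \<circ> a) (g \<circ> b) H"
  shows "pmap V (hpullback X Y Z f g) (whisker_into a b H)"
proof -
  have "continuous_map (spc V)
      (prod_topology (spc X) (prod_topology (path_space (spc Z)) (spc Y))) (whisker_into a b H)"
    unfolding whisker_into_def
    using a b H
    by (intro continuous_map_pairedI continuous_map_curry_path_space)
       (simp_all add: pmap_def phomotopy_def)
  moreover have "whisker_into a b H \<in> topspace (spc V) \<rightarrow> {(x, p, y). p 0 = f x \<and> p 1 = g y}"
    using H by (auto simp: whisker_into_def phomotopy_def)
  moreover have "restrict (\<lambda>t. H (t, pt V)) {0..1} = restrict (\<lambda>t. pt Z) {0..1}"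
    using H by (intro restrict_ext) (simp add: phomotopy_def)
  ultimately show ?thesis
    using a b
    by (simp add: pmap_def hpullback_def continuous_map_in_subtopology whisker_into_def
        image_subset_iff_funcset)
qed

lemma hpb_fst_whisker_into: "hpb_fst \<circ> whisker_into a b H = a"
  by (simp add: fun_eq_iff hpb_fst_def whisker_into_def)

lemma hpb_snd_whisker_into: "hpb_snd \<circ> whisker_into a b H = b"
  by (simp add: fun_eq_iff hpb_snd_def whisker_into_def)

lemma hpullback_lift:
  assumes U: "pspace U" and u: "pmap U X u" and v: "pmap U Y v"
    and h: "phomotopic U Z (f \<circ> u) (g \<circ> v)"
  obtains w where "pmap U (hpullback X Y Z f g) w" "hpb_fst \<circ> w = u" "hpb_snd \<circ> w = v"
proof -
  obtain K where "phomotopy U Z (f \<circ> u) (g \<circ> v) K"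
    using h phomotopic_alt[OF U] by blast
  then show thesis
    using that whisker_into_pmap[OF U u v] hpb_fst_whisker_into hpb_snd_whisker_into by metis
qed

text \<open>
  The equivalence with the standard model transports its lifts to any homotopy pullback, where
  the two triangles then commute only up to homotopy.
\<close>

lemma is_hpullback_lift:
  assumes V: "is_hpullback V X Y Z f g a b H"
    and U: "pspace U" and u: "pmap U X u" and v: "pmap U Y v"
    and h: "phomotopic U Z (f \<circ> u) (g \<circ> v)"
  obtains k where "pmap U V k" "phomotopic U X (a \<circ> k) u" "phomotopic U Y (b \<circ> k) v"
proof -
  let ?P = "hpullback X Y Z f g" and ?e = "whisker_into a b H"
  obtain d where d: "pmap ?P V d" "phomotopic ?P ?P (?e \<circ> d) id"
    using V by (auto simp: is_hpullback_def phomotopy_equiv_def)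
  obtain w where w: "pmap U ?P w" "hpb_fst \<circ> w = u" "hpb_snd \<circ> w = v"
    using hpullback_lift[OF U u v h] .
  have ew: "phomotopic U ?P (?e \<circ> (d \<circ> w)) w"
    using phomotopic_comp_right[OF d(2) w(1)] by (simp add: comp_assoc)
  show thesis
  proof
    show "pmap U V (d \<circ> w)"
      using w(1) d(1) by (rule pmap_comp)
    show "phomotopic U X (a \<circ> (d \<circ> w)) u"
      using phomotopic_comp_left[OF ew hpb_pmap(1)]
      by (simp add: w(2) hpb_fst_whisker_into flip: comp_assoc)
    show "phomotopic U Y (b \<circ> (d \<circ> w)) v"
      using phomotopic_comp_left[OF ew hpb_pmap(2)]
      by (simp add: w(3) hpb_snd_whisker_into flip: comp_assoc)
  qed
qed

section \<open>Homotopy sections of a common map\<close>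

lemma phomotopic_sections_if_factor:
  assumes r: "pmap H S r" and s: "homotopy_section H S r s" and t: "homotopy_section H S r t"
    and k: "pmap S S k" and factor: "phomotopic S H s (t \<circ> k)"
  shows "phomotopic S H s t"
proof -
  have tm: "pmap S H t" and rs: "phomotopic S S (r \<circ> s) id" and rt: "phomotopic S S (r \<circ> t) id"
    using s t by (auto simp: homotopy_section_def)
  have "phomotopic S S k (r \<circ> (t \<circ> k))"
    using phomotopic_sym[OF phomotopic_comp_right[OF rt k]] by (simp add: comp_assoc)
  also have "phomotopic S S (r \<circ> (t \<circ> k)) (r \<circ> s)"
    using phomotopic_sym[OF phomotopic_comp_left[OF factor r]] .
  also note rs
  finally have "phomotopic S H (t \<circ> k) t"
    using phomotopic_comp_left[OF _ tm, of S k id] by simp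
  then show ?thesis
    using factor phomotopic_trans by blast
qed

text \<open>
  The universal homotopy only compares \<open>s\<close> and \<open>t\<close> along the two different projections of the
  pullback; these are homotopic because \<open>s\<close> and \<open>t\<close> have a common left inverse up to homotopy.
\<close>

lemma sections_agree_on_hpullback:
  assumes r: "pmap H S r" and s: "homotopy_section H S r s" and t: "homotopy_section H S r t"
    and S: "pspace S" "pspace H"
  shows "phomotopic (hpullback S S H s t) H (s \<circ> hpb_fst) (t \<circ> hpb_fst)"
proof -
  let ?Q = "hpullback S S H s t"
  have sm: "pmap S H s" and tm: "pmap S H t"
    and rs: "phomotopic S S (r \<circ> s) id" and rt: "phomotopic S S (r \<circ> t) id"
    using s t by (auto simp: homotopy_section_def)
  have "pspace ?Q"
    using S sm tm by (intro hpullback_pspace)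
  then have st: "phomotopic ?Q H (s \<circ> hpb_fst) (t \<circ> hpb_snd)"
    using hpb_homotopy[OF sm tm] phomotopic_alt by blast
  have "phomotopic ?Q S hpb_snd (r \<circ> (t \<circ> hpb_snd))"
    using phomotopic_sym[OF phomotopic_comp_right[OF rt hpb_pmap(2)]] by (simp add: comp_assoc)
  also have "phomotopic ?Q S (r \<circ> (t \<circ> hpb_snd)) (r \<circ> (s \<circ> hpb_fst))"
    using phomotopic_sym[OF phomotopic_comp_left[OF st r]] .
  also have "phomotopic ?Q S (r \<circ> (s \<circ> hpb_fst)) hpb_fst"
    using phomotopic_comp_right[OF rs hpb_pmap(1)] by (simp add: comp_assoc)
  finally have "phomotopic ?Q H (t \<circ> hpb_snd) (t \<circ> hpb_fst)"
    by (rule phomotopic_comp_left[OF _ tm])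
  with st show ?thesis
    by (rule phomotopic_trans)
qed

lemma homotopy_epi_if_section:
  fixes Q :: "'q ptop" and Y :: "'y ptop"
  assumes s: "homotopy_section Q Y p s"
  shows "homotopy_epi Q Y p"
  unfolding homotopy_epi_def
proof (intro allI impI)
  fix Z :: "('y + 'y + real \<times> 'q) ptop" and u v
  assume uv: "pmap Y Z u" "pmap Y Z v" and h: "phomotopic Q Z (u \<circ> p) (v \<circ> p)"
  have sm: "pmap Y Q s" and ps: "phomotopic Y Y (p \<circ> s) id"
    using s by (auto simp: homotopy_section_def)
  have "phomotopic Y Z u (u \<circ> (p \<circ> s))"
    using phomotopic_sym[OF phomotopic_comp_left[OF ps uv(1)]] by simp
  also have "phomotopic Y Z (u \<circ> (p \<circ> s)) (v \<circ> (p \<circ> s))"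
    using phomotopic_comp_right[OF h sm] by (simp add: comp_assoc)
  also have "phomotopic Y Z (v \<circ> (p \<circ> s)) v"
    using phomotopic_comp_left[OF ps uv(2)] by simp
  finally show "phomotopic Y Z u v" .
qed

lemma sections_coincide_if_projection_epi:
  assumes r: "pmap H S r" and s: "homotopy_section H S r s" and t: "homotopy_section H S r t"
    and S: "pspace S" "pspace H" and epi: "homotopy_epi (hpullback S S H s t) S hpb_fst"
  shows "phomotopic S H s t"
proof (rule homotopy_epi_universal[OF _ S epi])
  show sm: "pmap S H s" and tm: "pmap S H t"
    using s t by (auto simp: homotopy_section_def)
  show "pspace (hpullback S S H s t)"
    using S sm tm by (intro hpullback_pspace)
  show "phomotopic (hpullback S S H s t) H (s \<circ> hpb_fst) (t \<circ> hpb_fst)"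
    using r s t S by (rule sections_agree_on_hpullback)
qed

lemma projection_has_section_if_phomotopic:
  assumes S: "pspace S" and h: "phomotopic S H s t"
  shows "\<exists>q. homotopy_section (hpullback S S H s t) S hpb_fst q"
proof -
  have "phomotopic S H (s \<circ> id) (t \<circ> id)"
    using h by simp
  then obtain q where "pmap S (hpullback S S H s t) q" "hpb_fst \<circ> q = id"
    by (rule hpullback_lift[OF S pmap_id pmap_id])
  then show ?thesis
    unfolding homotopy_section_def by (metis phomotopic_refl[OF pmap_id])
qed

section \<open>Comparison of \<open>\<sigma> \<circ> f\<close> with \<open>\<omega>\<close>\<close>


theorem proposition20:
  fixes W :: "'w ptop" and A :: "'a ptop" and S :: "'s ptop" and X :: "'x ptop"
    and \<eta> \<beta> :: "'w \<Rightarrow> 'a" and \<theta> :: "'a \<Rightarrow> 's" and T :: "real \<times> 'w \<Rightarrow> 's"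
    and f :: "'s \<Rightarrow> 'x" and n :: nat
    and G :: "('a, 'x) gpt ptop" and g :: "('a, 'x) gpt \<Rightarrow> 'x"
    and \<sigma> :: "'x \<Rightarrow> ('a, 'x) gpt" and \<omega> :: "'s \<Rightarrow> ('a, 'x) gpt"
    and H :: "(('a, 'x) gpt \<times> (real \<Rightarrow> 'x) \<times> 's) ptop"
    and J :: "real \<times> 's \<Rightarrow> 'x"
    and \<theta>W \<sigma>bar :: "'s \<Rightarrow> ('a, 'x) gpt \<times> (real \<Rightarrow> 'x) \<times> 's"
    and L :: "real \<times> 's \<Rightarrow> ('a, 'x) gpt"
    and Q :: "('s \<times> (real \<Rightarrow> ('a, 'x) gpt \<times> (real \<Rightarrow> 'x) \<times> 's) \<times> 's) ptop"
    and \<pi> :: "'s \<times> (real \<Rightarrow> ('a, 'x) gpt \<times> (real \<Rightarrow> 'x) \<times> 's) \<times> 's \<Rightarrow> 's"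
  assumes spaces: "pspace W" "pspace A" "pspace S" "pspace X"
    and maps: "pmap W A \<eta>" "pmap W A \<beta>"
    and pushout: "is_hpushout W A A S \<eta> \<beta> \<theta> \<theta> T"
    and f: "pmap S X f"
    and n: "n \<ge> 1" "secat A X (f \<circ> \<theta>) \<le> enat n"
    and G: "G = ganea_space A X (f \<circ> \<theta>) n" "g = ganea_map A X (f \<circ> \<theta>) n"
    and \<sigma>: "homotopy_section G X g \<sigma>"
    and \<omega>: "is_omega W A S X \<eta> \<beta> \<theta> T f n \<omega>"
    and H: "H = hpullback G S X g f"
    and \<theta>W: "phomotopy S X (g \<circ> \<omega>) (f \<circ> id) J" "\<theta>W = whisker_into \<omega> id J"
    and \<sigma>bar: "is_hpullback S X H G \<sigma> hpb_fst f \<sigma>bar L" "phomotopic S S (hpb_snd \<circ> \<sigma>bar) id"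
    and Q: "Q = hpullback S S H \<theta>W \<sigma>bar" "\<pi> = hpb_fst"
  shows "(phomotopic S G (\<sigma> \<circ> f) \<omega> \<longleftrightarrow> (\<exists>s. homotopy_section Q S \<pi> s))
       \<and> ((\<exists>s. homotopy_section Q S \<pi> s) \<longleftrightarrow> homotopy_epi Q S \<pi>)
       \<and> (homotopy_epi Q S \<pi> \<longleftrightarrow> phomotopic S H \<theta>W \<sigma>bar)"
proof -
  have \<theta>: "pmap A S \<theta>"
    using pushout by (simp add: is_hpushout_def)
  have Gok: "pspace G" "pmap G X g"
    using ganea_ok[OF spaces(2,4) pmap_comp[OF \<theta> f], of n] by (auto simp: G)
  have \<omega>m: "pmap S G \<omega>"
    using \<omega> by (simp add: is_omega_def Let_def G)
  have Hsp: "pspace H"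
    unfolding H using Gok spaces f by (intro hpullback_pspace)
  have proj: "pmap H G hpb_fst" "pmap H S hpb_snd"
    unfolding H by (rule hpb_pmap)+
  have "pmap S H \<theta>W"
    unfolding H \<theta>W(2) using spaces(3) \<omega>m pmap_id \<theta>W(1) by (rule whisker_into_pmap)
  then have \<theta>W_section: "homotopy_section H S hpb_snd \<theta>W"
    using phomotopic_refl[OF pmap_id]
    by (simp add: homotopy_section_def \<theta>W(2) hpb_snd_whisker_into)
  have \<theta>W_fst: "hpb_fst \<circ> \<theta>W = \<omega>"
    by (simp add: \<theta>W(2) hpb_fst_whisker_into)
  have \<sigma>bar_section: "homotopy_section H S hpb_snd \<sigma>bar"
    using \<sigma>bar by (simp add: homotopy_section_def is_hpullback_def)
  have \<sigma>bar_fst: "phomotopic S G (\<sigma> \<circ> f) (hpb_fst \<circ> \<sigma>bar)"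
    using \<sigma>bar(1) unfolding is_hpullback_def phomotopic_alt[OF spaces(3)] by blast
  have "phomotopic S H \<theta>W \<sigma>bar" if "phomotopic S G (\<sigma> \<circ> f) \<omega>"
  proof -
    have "phomotopic S G (\<sigma> \<circ> f) (hpb_fst \<circ> \<theta>W)"
      using that by (simp add: \<theta>W_fst)
    then obtain k where "pmap S S k" "phomotopic S H (\<sigma>bar \<circ> k) \<theta>W"
      using is_hpullback_lift[OF \<sigma>bar(1) spaces(3) f \<open>pmap S H \<theta>W\<close>] by blast
    then show ?thesis
      using phomotopic_sections_if_factor[OF proj(2) \<theta>W_section \<sigma>bar_section] phomotopic_sym
      by blast
  qed
  moreover have "phomotopic S G (\<sigma> \<circ> f) \<omega>" if "phomotopic S H \<theta>W \<sigma>bar"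
    using phomotopic_trans[OF \<sigma>bar_fst] phomotopic_comp_left[OF phomotopic_sym[OF that] proj(1)]
    by (simp add: \<theta>W_fst)
  moreover have "\<exists>s. homotopy_section Q S \<pi> s" if "phomotopic S H \<theta>W \<sigma>bar"
    using projection_has_section_if_phomotopic[OF spaces(3) that] by (simp add: Q)
  moreover have "homotopy_epi Q S \<pi>" if "\<exists>s. homotopy_section Q S \<pi> s"
    using that homotopy_epi_if_section by blast
  moreover have "phomotopic S H \<theta>W \<sigma>bar" if "homotopy_epi Q S \<pi>"
    using sections_coincide_if_projection_epi[OF proj(2) \<theta>W_section \<sigma>bar_section spaces(3) Hsp]
      that by (simp add: Q)
  ultimately show ?thesis
    by blast
qed

end
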